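(* Let $\mathcal U$ be an admissible trigger set with continue set $\overline{\mathcal U}=\mathcal S\setminus\mathcal U$, and for each state $\bm i$ let $\rho_{\bm i}$ be the probability that $\bm i$ is visited during a cycle starting from $\bm i^0$. Then the expected cost per cycle $E_{\overline{\mathcal U}}[TC]$ and the expected cycle length $E_{\overline{\mathcal U}}[T]$ can be expressed solely in terms of the continue states: $$E_{\overline{\mathcal U}}[TC]=G(\bm i^0)+\sum_{\bm i\in\overline{\mathcal U}}\frac{\hat g(\bm i)}{\Lambda}\rho_{\bm i},\qquad E_{\overline{\mathcal U}}[T]=\tau+\sum_{\bm i\in\overline{\mathcal U}}\frac1\Lambda\rho_{\bm i},$$ so that the average cost per unit time is $$\alpha_{\overline{\mathcal U}}=\frac{E_{\overline{\mathcal U}}[TC]}{E_{\overline{\mathcal U}}[T]}=\frac{G(\bm i^0)+\sum_{\bm i\in\overline{\mathcal U}}\frac{\hat g(\bm i)}{\Lambda}\rho_{\bm i}}{\tau+\sum_{\bm i\in\overline{\mathcal U}}\frac1\Lambda\rho_{\bm i}}.$$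
   Context: Setting. There are $J\ge 1$ items. For each item $j$ let $Q_j\ge 1$ be an integer (slot capacity), $\lambda_j>0$ the demand rate and $b_j>0$ the unit stockout cost. $A>0$ is the fixed replenishment cost and $\tau>0$ the lead time. Put $\Lambda=\sum_{j=1}^J\lambda_j$ and $p_j=\lambda_j/\Lambda$. $D_j(\tau)$ is a Poisson random variable with mean $\lambda_j\tau$ (so $P(D_j(\tau)=r)=0$ for $r<0$). The state space is $\mathcal S=\{\bm i=(i_1,\dots,i_J)\in\mathbb Z^J: i_j\le Q_j\ \forall j\}$; the initial state is $\bm i^0=\bm Q=(Q_1,\dots,Q_J)$; $\bm i^{-j}$ denotes $\bm i$ with its $j$-th coordinate decreased by $1$. Define $$G(\bm i)=A+\sum_{j=1}^J b_j\sum_{r=i_j}^\infty (r-i_j)P(D_j(\tau)=r),\qquad \hat g(\bm i)=\sum_{j=1}^J\lambda_jb_jP(D_j(\tau)\ge i_j).$$ Dynamics. Starting from $\bm i^0$, the chain $\bm i^0,\bm i^1,\bm i^2,\dots$ moves at each step from $\bm i$ to $\bm i^{-j}$ with probability $p_j$; each step takes mean time $1/\Lambda$. A trigger set is a subset $\mathcal U\subset\mathcal S$. When the chain first enters $\mathcal U$, at step $N_{\mathcal U}$, a replenishment is triggered, which takes time $\tau$, costs $G(\bm i^{N_{\mathcal U}})$ and returns the system to $\bm i^0$, ending the cycle. $\mathcal U$ is admissible if $\bm i^0\notin\mathcal U$ and $E[N_{\mathcal U}]<\infty$. The cost per cycle is $TC=G(\bm i^{N_{\mathcal U}})$ (no other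 costs are incurred), so $E_{\overline{\mathcal U}}[TC]=E[G(\bm i^{N_{\mathcal U}})]$, and the expected cycle length is $E_{\overline{\mathcal U}}[T]=\tau+E[N_{\mathcal U}]/\Lambda$. The states visited in a cycle are $\bm i^0,\bm i^1,\dots,\bm i^{N_{\mathcal U}}$. *)

theory Defs
  imports "HOL-Probability.Probability"
begin

text \<open>
  The items are the elements of a finite type \<open>'j\<close> (so \<open>CARD('j)\<close> is the number of items, which is
  at least one), and a state assigns to every item its integer inventory position.
\<close>

type_synonym 'j state = "'j \<Rightarrow> int"

definition states :: "('j \<Rightarrow> nat) \<Rightarrow> 'j state set" where
  "states Q = {i. \<forall>j. i j \<le> int (Q j)}"

definition full_state :: "('j \<Rightarrow> nat) \<Rightarrow> 'j state" where
  "full_state Q = (\<lambda>j. int (Q j))"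

definition decr :: "'j state \<Rightarrow> 'j \<Rightarrow> 'j state" where
  "decr i j = i(j := i j - 1)"

definition total_rate :: "('j::finite \<Rightarrow> real) \<Rightarrow> real" where
  "total_rate lam = (\<Sum>j\<in>UNIV. lam j)"

definition demand_prob :: "('j::finite \<Rightarrow> real) \<Rightarrow> 'j \<Rightarrow> real" where
  "demand_prob lam j = lam j / total_rate lam"

text \<open>
  The law of the lead-time demand, transported to the integers because the inventory position it
  is compared with may be negative.
\<close>

definition lead_demand :: "real \<Rightarrow> ('j \<Rightarrow> real) \<Rightarrow> 'j \<Rightarrow> int pmf" where
  "lead_demand \<tau> lam j = map_pmf int (poisson_pmf (lam j * \<tau>))"

definition G ::
  "real \<Rightarrow> real \<Rightarrow> ('j::finite \<Rightarrow> real) \<Rightarrow> ('j \<Rightarrow> real) \<Rightarrow> 'j state \<Rightarrow> real" where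
  "G A \<tau> lam b i =
     A + (\<Sum>j\<in>UNIV. b j *
       (\<Sum>\<^sub>\<infinity>r\<in>{i j..}. of_int (r - i j) * pmf (lead_demand \<tau> lam j) r))"

definition g_hat ::
  "real \<Rightarrow> ('j::finite \<Rightarrow> real) \<Rightarrow> ('j \<Rightarrow> real) \<Rightarrow> 'j state \<Rightarrow> real" where
  "g_hat \<tau> lam b i =
     (\<Sum>j\<in>UNIV. lam j * b j * \<P>(r in lead_demand \<tau> lam j. i j \<le> r))"

text \<open>
  \<open>X\<close> is a Markov chain on the probability space \<open>M\<close> that starts in the full state and moves from
  \<open>i\<close> to \<open>decr i j\<close> with probability \<open>demand_prob lam j\<close>. The Markov property is stated through
  the probabilities of finite paths \<open>x 0, \<dots>, x n\<close>, so that no conditioning on null events occurs.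
  As the states \<open>decr i j\<close> are distinct for distinct \<open>j\<close>, no other transitions are possible.
\<close>

definition inventory_chain ::
  "'w measure \<Rightarrow> (nat \<Rightarrow> 'w \<Rightarrow> 'j state) \<Rightarrow> ('j::finite \<Rightarrow> nat) \<Rightarrow> ('j \<Rightarrow> real) \<Rightarrow> bool" where
  "inventory_chain M X Q lam \<longleftrightarrow>
     prob_space M \<and>
     (\<forall>n. X n \<in> measurable M (count_space UNIV)) \<and>
     (AE \<omega> in M. X 0 \<omega> = full_state Q) \<and>
     (\<forall>n x j. \<P>(\<omega> in M. (\<forall>k\<le>n. X k \<omega> = x k) \<and> X (Suc n) \<omega> = decr (x n) j) =
        \<P>(\<omega> in M. \<forall>k\<le>n. X k \<omega> = x k) * demand_prob lam j)"

definition trigger_step :: "(nat \<Rightarrow> 'w \<Rightarrow> 'j state) \<Rightarrow> 'j state set \<Rightarrow> 'w \<Rightarrow> enat" where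
  "trigger_step X U \<omega> =
     (if \<exists>n. X n \<omega> \<in> U then enat (LEAST n. X n \<omega> \<in> U) else \<infinity>)"

definition expected_steps ::
  "'w measure \<Rightarrow> (nat \<Rightarrow> 'w \<Rightarrow> 'j state) \<Rightarrow> 'j state set \<Rightarrow> ennreal" where
  "expected_steps M X U = (\<integral>\<^sup>+ \<omega>. ennreal_of_enat (trigger_step X U \<omega>) \<partial>M)"

definition admissible ::
  "'w measure \<Rightarrow> (nat \<Rightarrow> 'w \<Rightarrow> 'j state) \<Rightarrow> ('j \<Rightarrow> nat) \<Rightarrow> 'j state set \<Rightarrow> bool" where
  "admissible M X Q U \<longleftrightarrow>
     U \<subseteq> states Q \<and> full_state Q \<notin> U \<and> expected_steps M X U < \<infinity>"

text \<open>
  The value on paths that never enter \<open>U\<close> is immaterial: for admissible \<open>U\<close> they form a null set.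
\<close>

definition cycle_cost ::
  "(nat \<Rightarrow> 'w \<Rightarrow> 'j state) \<Rightarrow> 'j state set \<Rightarrow> ('j state \<Rightarrow> real) \<Rightarrow> 'w \<Rightarrow> real" where
  "cycle_cost X U c \<omega> =
     (case trigger_step X U \<omega> of enat n \<Rightarrow> c (X n \<omega>) | \<infinity> \<Rightarrow> 0)"

definition expected_cost ::
  "'w measure \<Rightarrow> (nat \<Rightarrow> 'w \<Rightarrow> 'j state) \<Rightarrow> 'j state set \<Rightarrow> ('j state \<Rightarrow> real) \<Rightarrow> real" where
  "expected_cost M X U c = (\<integral>\<omega>. cycle_cost X U c \<omega> \<partial>M)"

text \<open>The lead time plus the mean number of steps, each of mean duration \<open>1 / total_rate lam\<close>.\<close>

definition expected_length ::
  "'w measure \<Rightarrow> (nat \<Rightarrow> 'w \<Rightarrow> 'j state) \<Rightarrow> 'j state set \<Rightarrow> real \<Rightarrow> ('j::finite \<Rightarrow> real) \<Rightarrow> real"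
  where
  "expected_length M X U \<tau> lam = \<tau> + enn2real (expected_steps M X U) / total_rate lam"

definition average_cost ::
  "'w measure \<Rightarrow> (nat \<Rightarrow> 'w \<Rightarrow> 'j state) \<Rightarrow> 'j state set \<Rightarrow> ('j state \<Rightarrow> real) \<Rightarrow> real \<Rightarrow>
     ('j::finite \<Rightarrow> real) \<Rightarrow> real" where
  "average_cost M X U c \<tau> lam = expected_cost M X U c / expected_length M X U \<tau> lam"

definition visit_prob ::
  "'w measure \<Rightarrow> (nat \<Rightarrow> 'w \<Rightarrow> 'j state) \<Rightarrow> 'j state set \<Rightarrow> 'j state \<Rightarrow> real" where
  "visit_prob M X U i = \<P>(\<omega> in M. \<exists>n. enat n \<le> trigger_step X U \<omega> \<and> X n \<omega> = i)"

end

theory Submission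
  imports Defs
begin

text \<open>
  The shortage cost grows by \<open>b j * P(D j \<ge> i j)\<close> when item \<open>j\<close> is demanded in state \<open>i\<close>, so the
  mean one-step increment of \<open>G\<close> out of \<open>i\<close> is \<open>g_hat i / total_rate lam\<close>. The cost at the trigger
  step is \<open>G\<close> of the full state plus the increments along the path before that step, and the Markov
  property turns the expectation of this sum into the expected sum of \<open>g_hat / total_rate lam\<close> over
  the continue states visited. As every demand lowers the total inventory by one, no state is visited
  twice, and the expected number of visits to a state is its visit probability. All increments
  are nonnegative, so the interchanges of sums and expectations need no integrability beforehand.
\<close>

section \<open>Shortage of the Poisson lead-time demand and the increments of
  \<open>G\<close>\<close>

text \<open>The Poisson law has a finite mean: the terms are dominated by those of
  \<open>n * c^n / n!\<close> plus \<open>|x| * c^n / n!\<close>, both exponential series.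
  Summability is what allows the infinite sum of the shortage to be split further on.\<close>

lemma lead_demand_moment_summable:
  assumes "lam j > 0" "\<tau> > 0"
  shows "(\<lambda>r. of_int (r - x) * pmf (lead_demand \<tau> lam j) r) summable_on I"
proof -
  let ?p = "lead_demand \<tau> lam j" and ?c = "lam j * \<tau>"
  have c: "?c > 0" using assms by simp
  have pmf: "pmf ?p (int n) = ?c ^ n / fact n * exp (- ?c)" for n
    unfolding lead_demand_def using c by (subst pmf_map_inj') (auto simp: inj_on_def)
  have zero: "pmf ?p r = 0" if "r \<notin> range int" for r
    using that by (auto simp: lead_demand_def set_pmf_eq[symmetric] pmf_eq_0_set_pmf)
  have "summable (\<lambda>n. norm (real n * (?c ^ n / fact n)))"
  \<comment> \<open>Shifting the index cancels the factor \<open>n\<close> against the factorial and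
    leaves \<open>c\<close> times the exponential series.\<close>
  proof (subst summable_Suc_iff[symmetric], rule summable_cong[THEN iffD2])
    show "\<forall>\<^sub>F n in sequentially. norm (real (Suc n) * (?c ^ Suc n / fact (Suc n))) =
        ?c * (inverse (fact n) * ?c ^ n)"
      using c assms by (intro always_eventually) (auto simp: field_simps simp del: of_nat_Suc)
    show "summable (\<lambda>n. ?c * (inverse (fact n) * ?c ^ n))"
      by (intro summable_mult summable_exp)
  qed
  moreover have "summable (\<lambda>n. norm (of_int x * (?c ^ n / fact n)))"
    using summable_mult[OF summable_exp[of ?c], of "\<bar>of_int x\<bar>"] c assms
    by (simp add: abs_mult field_simps)
  ultimately have "summable (\<lambda>n. norm (real n * (?c ^ n / fact n)) + norm (of_int x * (?c ^ n / fact n)))"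
    by (rule summable_add)
  then have "summable (\<lambda>n. (norm (real n * (?c ^ n / fact n)) + norm (of_int x * (?c ^ n / fact n))) * exp (- ?c))"
    by (rule summable_mult2)
  then have "summable (\<lambda>n. norm (of_int (int n - x) * pmf ?p (int n)))"
  proof (rule summable_comparison_test')
    fix n :: nat assume "n \<ge> 0"
    have "norm (norm (of_int (int n - x) * pmf ?p (int n))) =
      \<bar>real n - of_int x\<bar> * (?c ^ n / fact n) * exp (- ?c)"
      using c assms by (simp add: pmf abs_mult)
    also have "\<dots> \<le> (\<bar>real n\<bar> + \<bar>of_int x\<bar>) * (?c ^ n / fact n) * exp (- ?c)"
      using c assms by (intro mult_right_mono) (auto simp: abs_triangle_ineq4)
    also have "\<dots> = (norm (real n * (?c ^ n / fact n)) + norm (of_int x * (?c ^ n / fact n))) * exp (- ?c)"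
      using c assms by (simp add: abs_mult algebra_simps add_divide_distrib)
    finally show "norm (norm (of_int (int n - x) * pmf ?p (int n))) \<le> \<dots>" .
  qed
  then have "(\<lambda>n. of_int (int n - x) * pmf ?p (int n)) summable_on UNIV"
    by (rule norm_summable_imp_summable_on)
  then have "(\<lambda>r. of_int (r - x) * pmf ?p r) summable_on range int"
    by (subst summable_on_reindex) (auto simp: o_def)
  \<comment> \<open>The law charges only \<open>range int\<close>, so the remaining integers add
    zero terms.\<close>
  then have "(\<lambda>r. of_int (r - x) * pmf ?p r) summable_on UNIV"
    by (rule summable_on_cong_neutral[THEN iffD1, rotated -1]) (auto simp: zero)
  then show ?thesis
    by (rule summable_on_subset_banach) simp
qed

text \<open>Lowering the threshold by one raises each shortage \<open>r - x\<close> with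
  \<open>x \<le> r\<close> by one, and the new term \<open>r = x - 1\<close> has weight zero. The
  total rise is therefore the tail probability.\<close>

lemma lead_demand_shortage_decr:
  assumes "lam j > 0" "\<tau> > 0"
  shows "(\<Sum>\<^sub>\<infinity>r\<in>{x - 1..}. of_int (r - (x - 1)) * pmf (lead_demand \<tau> lam j) r) =
    (\<Sum>\<^sub>\<infinity>r\<in>{x..}. of_int (r - x) * pmf (lead_demand \<tau> lam j) r) +
    \<P>(r in lead_demand \<tau> lam j. x \<le> r)"
proof -
  let ?p = "lead_demand \<tau> lam j"
  have summable: "pmf ?p summable_on {x..}"
    using pmf_abs_summable[of ?p "{x..}"] abs_summable_equivalent abs_summable_summable by blast
  have "(\<Sum>\<^sub>\<infinity>r\<in>{x - 1..}. of_int (r - (x - 1)) * pmf ?p r) =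
      (\<Sum>\<^sub>\<infinity>r\<in>{x..}. of_int (r - x) * pmf ?p r + pmf ?p r)"
  proof (rule infsum_cong_neutral)
    fix r assume "r \<in> {x - 1..} - {x..}"
    then have "r = x - 1" by simp
    then show "of_int (r - (x - 1)) * pmf ?p r = 0" by simp
  qed (auto simp: algebra_simps)
  also have "\<dots> = (\<Sum>\<^sub>\<infinity>r\<in>{x..}. of_int (r - x) * pmf ?p r) + (\<Sum>\<^sub>\<infinity>r\<in>{x..}. pmf ?p r)"
    using summable by (intro infsum_add lead_demand_moment_summable assms)
  also have "(\<Sum>\<^sub>\<infinity>r\<in>{x..}. pmf ?p r) = \<P>(r in ?p. x \<le> r)"
    by (simp add: infsetsum_infsum[OF pmf_abs_summable, symmetric] measure_pmf_conv_infsetsum atLeast_def)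
  finally show ?thesis .
qed

text \<open>Only the summand of item \<open>j\<close> changes, by the tail probability weighted with
  \<open>b j\<close>. Weighting these increments with \<open>demand_prob\<close> later produces
  \<open>g_hat\<close>.\<close>

lemma G_decr:
  assumes "lam j > 0" "\<tau> > 0"
  shows "G A \<tau> lam b (decr i j) =
    G A \<tau> lam b i + b j * \<P>(r in lead_demand \<tau> lam j. i j \<le> r)"
proof -
  let ?H = "\<lambda>k x. b k * (\<Sum>\<^sub>\<infinity>r\<in>{x..}. of_int (r - x) * pmf (lead_demand \<tau> lam k) r)"
  have "(\<Sum>k\<in>UNIV. ?H k (decr i j k)) = ?H j (i j - 1) + (\<Sum>k\<in>UNIV - {j}. ?H k (i k))"
    by (subst sum.remove[of _ j]) (auto simp: decr_def intro!: sum.cong)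
  moreover have "(\<Sum>k\<in>UNIV. ?H k (i k)) = ?H j (i j) + (\<Sum>k\<in>UNIV - {j}. ?H k (i k))"
    by (subst sum.remove[of _ j]) auto
  ultimately show ?thesis
    using lead_demand_shortage_decr[where lam = lam and j = j and \<tau> = \<tau> and x = "i j", OF assms]
    unfolding G_def by (simp add: distrib_left)
qed

lemma G_nonneg:
  assumes "\<And>j. b j > 0" "A > 0"
  shows "0 \<le> G A \<tau> lam b i"
  unfolding G_def using assms
  by (intro add_nonneg_nonneg sum_nonneg mult_nonneg_nonneg infsum_nonneg) (auto simp: less_imp_le)

section \<open>The first entry into the trigger set\<close>

text \<open>This shows that the event depends on the path up to \<open>n\<close> alone, so that it
  can be combined with the Markov property for the move after step \<open>n\<close>.\<close>

lemma enat_less_trigger_step: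
  "enat n < trigger_step X U \<omega> \<longleftrightarrow> (\<forall>k\<le>n. X k \<omega> \<notin> U)"
proof (cases "\<exists>n. X n \<omega> \<in> U")
  case True
  define m where "m = (LEAST n. X n \<omega> \<in> U)"
  have hit: "X m \<omega> \<in> U" unfolding m_def by (rule LeastI_ex[OF True])
  have before: "X k \<omega> \<notin> U" if "k < m" for k
    using not_less_Least[of k "\<lambda>n. X n \<omega> \<in> U"] that unfolding m_def by blast
  have "trigger_step X U \<omega> = enat m"
    using True by (simp add: trigger_step_def m_def)
  moreover have "n < m \<longleftrightarrow> (\<forall>k\<le>n. X k \<omega> \<notin> U)"
    using hit before by (meson le_less_trans not_le)
  ultimately show ?thesis by simp
qed (simp add: trigger_step_def)

lemma X_trigger_step:
  assumes "trigger_step X U \<omega> = enat n"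
  shows "X n \<omega> \<in> U"
proof -
  from assms have ex: "\<exists>n. X n \<omega> \<in> U" and "n = (LEAST n. X n \<omega> \<in> U)"
    by (auto simp: trigger_step_def split: if_splits)
  then show ?thesis using LeastI_ex[OF ex] by simp
qed

text \<open>Counting the steps before \<open>t\<close> one at a time. After integration this is the
  tail-sum formula for the expected number of steps.\<close>

lemma ennreal_of_enat_eq_suminf:
  "ennreal_of_enat t = (\<Sum>n. if enat n < t then 1 else 0)"
proof (cases t)
  case (enat m)
  have "(\<Sum>n. if enat n < t then 1 else 0) = (\<Sum>n<m. 1::ennreal)"
    by (subst suminf_finite[of "{..<m}"]) (auto simp: enat)
  then show ?thesis by (simp add: enat)
next
  case infinity
  have "(\<Sum>n. 1::ennreal) = (SUP n. of_nat n)"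
    by (simp add: suminf_eq_SUP)
  then show ?thesis by (simp add: infinity ennreal_SUP_of_nat_eq_top)
qed

section \<open>From counting-measure integrals to infinite sums\<close>

text \<open>Sums over continue states are computed as extended nonnegative integrals. A finite value
  makes \<open>f\<close> integrable, hence absolutely summable, and the integral becomes the real
  infinite sum.\<close>

lemma nn_integral_count_space_infsum:
  assumes nonneg: "\<And>i. i \<in> S \<Longrightarrow> 0 \<le> f i"
    and eq: "(\<integral>\<^sup>+i. ennreal (f i) \<partial>count_space S) = ennreal a" and "0 \<le> a"
  shows "f summable_on S" and "infsum f S = a"
proof -
  have int: "integrable (count_space S) f"
    by (rule integrableI_nonneg) (use nonneg eq in \<open>auto simp: AE_count_space\<close>)
  then have abs: "Infinite_Set_Sum.abs_summable_on f S"
    by (simp add: abs_summable_on_def)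
  then show "f summable_on S"
    using abs_summable_equivalent abs_summable_summable by blast
  have "ennreal (\<integral>i. f i \<partial>count_space S) = ennreal a"
    using nn_integral_eq_integral[OF int] nonneg eq by (simp add: AE_count_space)
  then have "(\<integral>i. f i \<partial>count_space S) = a"
    using nonneg \<open>0 \<le> a\<close> by (subst (asm) ennreal_inj) (auto intro!: integral_nonneg_AE simp: AE_count_space)
  then show "infsum f S = a"
    using infsetsum_infsum[OF abs] by (simp add: infsetsum_def)
qed

section \<open>Total inventory and the moves between states\<close>

text \<open>A clock for the chain: the time can be read off the state, which rules out repeated
  visits.\<close>

definition level :: "'j::finite state \<Rightarrow> int" where
  "level i = (\<Sum>j\<in>UNIV. i j)"

lemma level_decr: "level (decr i j) = level i - 1"
proof -
  have "level (decr i j) = (i j - 1) + (\<Sum>k\<in>UNIV - {j}. i k)"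
    unfolding level_def by (subst sum.remove[of _ j]) (auto simp: decr_def intro!: sum.cong)
  moreover have "level i = i j + (\<Sum>k\<in>UNIV - {j}. i k)"
    unfolding level_def by (subst sum.remove[of _ j]) auto
  ultimately show ?thesis by simp
qed

lemma states_decr:
  assumes "i \<in> states Q"
  shows "decr i j \<in> states Q"
proof -
  have "decr i j k \<le> i k" for k by (simp add: decr_def)
  with assms show ?thesis unfolding states_def by (blast intro: order_trans)
qed

text \<open>Makes the events of a demand for different items at one step disjoint, so that their
  probabilities add.\<close>

lemma decr_eq_iff: "decr i j = decr i k \<longleftrightarrow> j = k"
proof
  assume "decr i j = decr i k"
  then have "decr i j j = decr i k j" by simp
  then show "j = k" by (simp add: decr_def split: if_splits)
qed simp

section \<open>The Markov property and almost sure path properties\<close>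

locale inventory_process =
  fixes M :: "'w measure" and X :: "nat \<Rightarrow> 'w \<Rightarrow> 'j::finite state"
    and Q :: "'j \<Rightarrow> nat" and lam :: "'j \<Rightarrow> real"
  assumes chain: "inventory_chain M X Q lam" and lam_pos: "\<And>j. lam j > 0"
begin

sublocale prob_space M
  using chain by (simp add: inventory_chain_def)

lemma X_measurable [measurable]: "X n \<in> measurable M (count_space UNIV)"
  using chain by (simp add: inventory_chain_def)

lemma total_rate_pos: "total_rate lam > 0"
  unfolding total_rate_def by (intro sum_pos lam_pos) auto

lemma demand_prob_nonneg: "demand_prob lam j \<ge> 0"
  using total_rate_pos lam_pos[of j] by (simp add: demand_prob_def)

lemma sum_demand_prob: "(\<Sum>j\<in>UNIV. demand_prob lam j) = 1"
  using total_rate_pos unfolding demand_prob_def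
  by (simp add: sum_divide_distrib[symmetric] total_rate_def)

text \<open>Extends the Markov property from single finite paths to nonnegative functionals
  \<open>g\<close> of the path up to \<open>n\<close>. Such a \<open>g\<close> can carry both the
  cost increment out of \<open>X n\<close> and the event that no trigger has occurred yet.\<close>

lemma markov_step:
  fixes g :: "(nat \<Rightarrow> 'j state) \<Rightarrow> ennreal"
  shows "(\<integral>\<^sup>+\<omega>. g (restrict (\<lambda>k. X k \<omega>) {..n}) * indicator {\<omega>. X (Suc n) \<omega> = decr (X n \<omega>) j} \<omega> \<partial>M) =
    ennreal (demand_prob lam j) * (\<integral>\<^sup>+\<omega>. g (restrict (\<lambda>k. X k \<omega>) {..n}) \<partial>M)"
proof -
  txt \<open>There are only countably many paths of length \<open>n\<close>, so it suffices to sum over them.\<close>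
  let ?H = "PiE {..n} (\<lambda>_. UNIV :: 'j state set)"
  let ?h = "\<lambda>\<omega>. restrict (\<lambda>k. X k \<omega>) {..n}"
  have count: "countable ?H" by (intro countable_PiE) auto
  have path_iff: "?h \<omega> = x \<longleftrightarrow> (\<forall>k\<le>n. X k \<omega> = x k)" if "x \<in> ?H" for x \<omega>
    using that by (auto simp: fun_eq_iff PiE_def extensional_def)
  \<comment> \<open>The event \<open>P\<close> is general because the decomposition is used twice:
    with the move along \<open>j\<close>, and with \<open>True\<close> to reassemble the integral
    without the move. For each outcome, only its own path contributes to the sum.\<close>
  have decomp: "(\<integral>\<^sup>+\<omega>. g (?h \<omega>) * indicator {\<omega>. P \<omega>} \<omega> \<partial>M) =
      (\<integral>\<^sup>+x. g x * emeasure M {\<omega>\<in>space M. (\<forall>k\<le>n. X k \<omega> = x k) \<and> P \<omega>} \<partial>count_space ?H)"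
    if [measurable]: "Measurable.pred M P" for P
  proof -
    have "(\<integral>\<^sup>+\<omega>. g (?h \<omega>) * indicator {\<omega>. P \<omega>} \<omega> \<partial>M) =
        (\<integral>\<^sup>+\<omega>. (\<integral>\<^sup>+x. g x * indicator {\<omega>\<in>space M. (\<forall>k\<le>n. X k \<omega> = x k) \<and> P \<omega>} \<omega> \<partial>count_space ?H) \<partial>M)"
    proof (rule nn_integral_cong)
      fix \<omega> assume \<omega>: "\<omega> \<in> space M"
      have "(\<integral>\<^sup>+x. g x * indicator {\<omega>\<in>space M. (\<forall>k\<le>n. X k \<omega> = x k) \<and> P \<omega>} \<omega> \<partial>count_space ?H) =
          (\<integral>\<^sup>+x. (g (?h \<omega>) * indicator {\<omega>. P \<omega>} \<omega>) * indicator {?h \<omega>} x \<partial>count_space ?H)"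
      proof (rule nn_integral_cong)
        fix x assume "x \<in> space (count_space ?H)"
        then have "(\<forall>k\<le>n. X k \<omega> = x k) \<longleftrightarrow> ?h \<omega> = x"
          using path_iff[of x \<omega>] by simp
        then show "g x * indicator {\<omega>\<in>space M. (\<forall>k\<le>n. X k \<omega> = x k) \<and> P \<omega>} \<omega> =
            (g (?h \<omega>) * indicator {\<omega>. P \<omega>} \<omega>) * indicator {?h \<omega>} x"
          using \<omega> by (cases "?h \<omega> = x") (simp_all add: indicator_def)
      qed
      also have "\<dots> = g (?h \<omega>) * indicator {\<omega>. P \<omega>} \<omega>"
        by (subst nn_integral_cmult_indicator) (auto simp: emeasure_count_space)
      finally show "g (?h \<omega>) * indicator {\<omega>. P \<omega>} \<omega> =
        (\<integral>\<^sup>+x. g x * indicator {\<omega>\<in>space M. (\<forall>k\<le>n. X k \<omega> = x k) \<and> P \<omega>} \<omega> \<partial>count_space ?H)" ..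
    qed
    also have "\<dots> = (\<integral>\<^sup>+x. (\<integral>\<^sup>+\<omega>. g x * indicator {\<omega>\<in>space M. (\<forall>k\<le>n. X k \<omega> = x k) \<and> P \<omega>} \<omega> \<partial>M) \<partial>count_space ?H)"
      by (rule nn_integral_count_space_nn_integral[OF count]) measurable
    also have "\<dots> = (\<integral>\<^sup>+x. g x * emeasure M {\<omega>\<in>space M. (\<forall>k\<le>n. X k \<omega> = x k) \<and> P \<omega>} \<partial>count_space ?H)"
      by (intro nn_integral_cong nn_integral_cmult_indicator) measurable
    finally show ?thesis .
  qed
  \<comment> \<open>The path event forces \<open>X n \<omega> = x n\<close>, so the target state of
    the move may be written through either. The conjunct \<open>True\<close> matches the form of
    \<open>decomp\<close>.\<close>
  have step: "emeasure M {\<omega>\<in>space M. (\<forall>k\<le>n. X k \<omega> = x k) \<and> X (Suc n) \<omega> = decr (X n \<omega>) j} =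
      ennreal (demand_prob lam j) * emeasure M {\<omega>\<in>space M. (\<forall>k\<le>n. X k \<omega> = x k) \<and> True}" for x
  proof -
    have "\<P>(\<omega> in M. (\<forall>k\<le>n. X k \<omega> = x k) \<and> X (Suc n) \<omega> = decr (x n) j) =
        \<P>(\<omega> in M. \<forall>k\<le>n. X k \<omega> = x k) * demand_prob lam j"
      using chain unfolding inventory_chain_def by blast
    moreover have "{\<omega>\<in>space M. (\<forall>k\<le>n. X k \<omega> = x k) \<and> X (Suc n) \<omega> = decr (x n) j} =
        {\<omega>\<in>space M. (\<forall>k\<le>n. X k \<omega> = x k) \<and> X (Suc n) \<omega> = decr (X n \<omega>) j}"
      by auto
    ultimately show ?thesis
      by (simp add: emeasure_eq_measure ennreal_mult'[symmetric] demand_prob_nonneg mult.commute)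
  qed
  have [measurable]: "Measurable.pred M (\<lambda>\<omega>. X (Suc n) \<omega> = decr (X n \<omega>) j)"
    by measurable
  have "(\<integral>\<^sup>+\<omega>. g (?h \<omega>) * indicator {\<omega>. X (Suc n) \<omega> = decr (X n \<omega>) j} \<omega> \<partial>M) =
      (\<integral>\<^sup>+x. ennreal (demand_prob lam j) *
        (g x * emeasure M {\<omega>\<in>space M. (\<forall>k\<le>n. X k \<omega> = x k) \<and> True}) \<partial>count_space ?H)"
    by (subst decomp) (auto simp: step mult_ac)
  also have "\<dots> = ennreal (demand_prob lam j) *
      (\<integral>\<^sup>+\<omega>. g (?h \<omega>) * indicator {\<omega>. True} \<omega> \<partial>M)"
    by (subst decomp) (simp, rule nn_integral_cmult, simp)
  finally show ?thesis by simp
qed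

text \<open>Taking \<open>g\<close> constantly one in \<open>markov_step\<close> gives each move its
  unconditional probability \<open>demand_prob lam j\<close>. The moves are disjoint and these
  probabilities sum to one.\<close>

lemma AE_step: "AE \<omega> in M. \<forall>n. \<exists>j. X (Suc n) \<omega> = decr (X n \<omega>) j"
proof (subst AE_all_countable, intro allI)
  fix n
  have "emeasure M {\<omega>\<in>space M. X (Suc n) \<omega> = decr (X n \<omega>) j} = ennreal (demand_prob lam j)" for j
  proof -
    have "(\<integral>\<^sup>+\<omega>. indicator {\<omega>. X (Suc n) \<omega> = decr (X n \<omega>) j} \<omega> \<partial>M) = ennreal (demand_prob lam j)"
      using markov_step[of "\<lambda>_. 1" n j] by (simp add: emeasure_space_1)
    also have "(\<integral>\<^sup>+\<omega>. indicator {\<omega>. X (Suc n) \<omega> = decr (X n \<omega>) j} \<omega> \<partial>M) =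
        (\<integral>\<^sup>+\<omega>. indicator {\<omega>\<in>space M. X (Suc n) \<omega> = decr (X n \<omega>) j} \<omega> \<partial>M)"
      by (rule nn_integral_cong) (auto simp: indicator_def)
    finally show ?thesis by simp
  qed
  then have "prob {\<omega>\<in>space M. X (Suc n) \<omega> = decr (X n \<omega>) j} = demand_prob lam j" for j
    by (simp add: emeasure_eq_measure demand_prob_nonneg)
  then have "prob (\<Union>j. {\<omega>\<in>space M. X (Suc n) \<omega> = decr (X n \<omega>) j}) = 1"
    by (subst finite_measure_finite_Union)
      (auto simp: disjoint_family_on_def decr_eq_iff sum_demand_prob)
  then show "AE \<omega> in M. \<exists>j. X (Suc n) \<omega> = decr (X n \<omega>) j"
    by (intro AE_I'[of "space M - (\<Union>j. {\<omega>\<in>space M. X (Suc n) \<omega> = decr (X n \<omega>) j})"])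
      (auto simp: null_sets_def emeasure_eq_measure prob_compl)
qed

lemma AE_path:
  "AE \<omega> in M. X 0 \<omega> = full_state Q \<and> (\<forall>n. \<exists>j. X (Suc n) \<omega> = decr (X n \<omega>) j) \<and>
     (\<forall>n. X n \<omega> \<in> states Q) \<and> inj (\<lambda>n. X n \<omega>)"
proof -
  have "AE \<omega> in M. X 0 \<omega> = full_state Q"
    using chain by (simp add: inventory_chain_def)
  with AE_step show ?thesis
  proof eventually_elim
    case (elim \<omega>)
    have states: "X n \<omega> \<in> states Q" for n
    proof (induction n)
      case (Suc n)
      obtain j where "X (Suc n) \<omega> = decr (X n \<omega>) j" using elim by blast
      with Suc show ?case by (simp add: states_decr)
    qed (use elim in \<open>simp add: states_def full_state_def\<close>)
    \<comment> \<open>Since the level after \<open>n\<close> steps determines \<open>n\<close>,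
      equal states force equal times.\<close>
    have level: "level (X n \<omega>) = level (X 0 \<omega>) - int n" for n
    proof (induction n)
      case (Suc n)
      obtain j where "X (Suc n) \<omega> = decr (X n \<omega>) j" using elim by blast
      with Suc show ?case by (simp add: level_decr)
    qed simp
    have "inj (\<lambda>n. X n \<omega>)"
    proof (rule injI)
      fix m n assume "X m \<omega> = X n \<omega>"
      then have "level (X m \<omega>) = level (X n \<omega>)" by (rule arg_cong)
      then show "m = n" using level[of m] level[of n] by linarith
    qed
    moreover have "\<forall>n. X n \<omega> \<in> states Q"
      using states by (rule allI)
    ultimately show ?case using elim by (intro conjI)
  qed
qed

section \<open>Measurability, expected steps and expected visits\<close>

lemma trigger_step_measurable [measurable]:
  "trigger_step X U \<in> measurable M (count_space UNIV)"
  unfolding trigger_step_def by measurable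

text \<open>The random index is removed by splitting over the countably many values of the trigger
  step.\<close>

lemma cycle_cost_measurable [measurable]: "cycle_cost X U c \<in> borel_measurable M"
  unfolding cycle_cost_def
proof (rule measurable_compose_countable[OF _ trigger_step_measurable])
  show "(\<lambda>\<omega>. case t of enat n \<Rightarrow> c (X n \<omega>) | \<infinity> \<Rightarrow> 0) \<in> borel_measurable M" for t
    by (cases t) auto
qed

lemma expected_steps_eq:
  "expected_steps M X U = (\<Sum>n. \<integral>\<^sup>+\<omega>. indicator {\<omega>. enat n < trigger_step X U \<omega>} \<omega> \<partial>M)"
  unfolding expected_steps_def ennreal_of_enat_eq_suminf
  by (subst nn_integral_suminf[symmetric])
    (auto simp: indicator_def intro!: nn_integral_cong suminf_cong)

text \<open>An occupation identity. Each state is visited at most once, so the indicator of a visit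
  to a continue state is the sum over \<open>n\<close> of the indicators of being there at a step
  before the trigger. Tonelli then exchanges states, steps and outcomes.\<close>

lemma nn_integral_visits:
  fixes f :: "'j state \<Rightarrow> real"
  assumes f: "\<And>i. f i \<ge> 0"
  shows "(\<integral>\<^sup>+i. ennreal (f i * visit_prob M X U i) \<partial>count_space (states Q - U)) =
    (\<Sum>n. \<integral>\<^sup>+\<omega>. ennreal (f (X n \<omega>)) * indicator {\<omega>. enat n < trigger_step X U \<omega>} \<omega> \<partial>M)"
proof -
  let ?S = "states Q - U" and ?T = "\<lambda>n. {\<omega>. enat n < trigger_step X U \<omega>}"
  have count: "countable ?S" by auto
  have "ennreal (f i * visit_prob M X U i) =
      (\<integral>\<^sup>+\<omega>. (\<Sum>n. ennreal (f (X n \<omega>)) * indicator (?T n) \<omega> * indicator {X n \<omega>} i) \<partial>M)"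
    if i: "i \<in> ?S" for i
  proof -
    have "ennreal (f i * visit_prob M X U i) = ennreal (f i) *
        emeasure M {\<omega>\<in>space M. \<exists>n. enat n \<le> trigger_step X U \<omega> \<and> X n \<omega> = i}"
      using f by (simp add: visit_prob_def emeasure_eq_measure ennreal_mult)
    also have "\<dots> = (\<integral>\<^sup>+\<omega>. ennreal (f i) *
        indicator {\<omega>\<in>space M. \<exists>n. enat n \<le> trigger_step X U \<omega> \<and> X n \<omega> = i} \<omega> \<partial>M)"
      by (rule nn_integral_cmult_indicator[symmetric]) measurable
    also have "\<dots> = (\<integral>\<^sup>+\<omega>. (\<Sum>n. ennreal (f (X n \<omega>)) * indicator (?T n) \<omega> * indicator {X n \<omega>} i) \<partial>M)"
    proof (rule nn_integral_cong_AE, use AE_path AE_space in eventually_elim)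
      case (elim \<omega>)
      \<comment> \<open>\<open>visit_prob\<close> also counts the trigger step itself, but the state
        there lies in \<open>U\<close>. For a continue state the inequality is thus strict.\<close>
      have le_iff: "enat n \<le> trigger_step X U \<omega> \<longleftrightarrow> enat n < trigger_step X U \<omega>" if "X n \<omega> = i" for n
        using X_trigger_step[of X U \<omega> n] that i by (auto simp: le_less)
      show ?case
      proof (cases "\<exists>n. X n \<omega> = i")
        case True
        then obtain n where n: "X n \<omega> = i" by blast
        \<comment> \<open>Injectivity of the path leaves at most one nonzero term in the sum over
          steps.\<close>
        then have uniq: "X k \<omega> = i \<longleftrightarrow> k = n" for k
          using elim by (auto dest: injD)
        have "(\<Sum>k. ennreal (f (X k \<omega>)) * indicator (?T k) \<omega> * indicator {X k \<omega>} i) =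
            ennreal (f i) * indicator (?T n) \<omega>"
          using uniq by (subst suminf_finite[of "{n}"]) (auto simp: n indicator_def)
        then show ?thesis
          using uniq le_iff n elim by (auto simp: indicator_def)
      next
        case False
        then have "indicator {X n \<omega>} i = (0 :: ennreal)" for n
          by (auto simp: indicator_def)
        with False show ?thesis by (simp add: indicator_def)
      qed
    qed
    finally show ?thesis .
  qed
  then have "(\<integral>\<^sup>+i. ennreal (f i * visit_prob M X U i) \<partial>count_space ?S) =
      (\<integral>\<^sup>+i. (\<integral>\<^sup>+\<omega>. (\<Sum>n. ennreal (f (X n \<omega>)) * indicator (?T n) \<omega> * indicator {X n \<omega>} i) \<partial>M) \<partial>count_space ?S)"
    by (intro nn_integral_cong) simp
  also have "\<dots> = (\<integral>\<^sup>+\<omega>. (\<integral>\<^sup>+i. (\<Sum>n. ennreal (f (X n \<omega>)) * indicator (?T n) \<omega> * indicator {X n \<omega>} i) \<partial>count_space ?S) \<partial>M)"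
    by (rule nn_integral_count_space_nn_integral[symmetric, OF count]) measurable
  also have "\<dots> = (\<integral>\<^sup>+\<omega>. (\<Sum>n. ennreal (f (X n \<omega>)) * indicator (?T n) \<omega>) \<partial>M)"
  proof (rule nn_integral_cong_AE, use AE_path in eventually_elim)
    case (elim \<omega>)
    have "(\<integral>\<^sup>+i. (\<Sum>n. ennreal (f (X n \<omega>)) * indicator (?T n) \<omega> * indicator {X n \<omega>} i) \<partial>count_space ?S) =
        (\<Sum>n. \<integral>\<^sup>+i. ennreal (f (X n \<omega>)) * indicator (?T n) \<omega> * indicator {X n \<omega>} i \<partial>count_space ?S)"
      by (rule nn_integral_suminf) simp
    also have "\<dots> = (\<Sum>n. ennreal (f (X n \<omega>)) * indicator (?T n) \<omega>)"
    proof (rule suminf_cong)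
      fix n
      show "(\<integral>\<^sup>+i. ennreal (f (X n \<omega>)) * indicator (?T n) \<omega> * indicator {X n \<omega>} i \<partial>count_space ?S) =
          ennreal (f (X n \<omega>)) * indicator (?T n) \<omega>"
      \<comment> \<open>Before the trigger \<open>X n \<omega>\<close> is a continue state, so the
        indicator integrates to one; otherwise both sides vanish.\<close>
      proof (cases "\<omega> \<in> ?T n")
        case True
        then have "X n \<omega> \<in> ?S"
          using elim by (auto simp: enat_less_trigger_step)
        then show ?thesis
          by (subst nn_integral_cmult_indicator) (auto simp: emeasure_count_space)
      qed simp
    qed
    finally show ?case .
  qed
  also have "\<dots> = (\<Sum>n. \<integral>\<^sup>+\<omega>. ennreal (f (X n \<omega>)) * indicator (?T n) \<omega> \<partial>M)"
    by (rule nn_integral_suminf) measurable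
  finally show ?thesis .
qed

section \<open>The expected cost at the trigger step\<close>

text \<open>On almost every path the trigger cost telescopes into the cost of the full state plus
  the increments. Splitting each increment by the demanded item lets \<open>markov_step\<close>
  average it.\<close>

lemma nn_integral_cycle_cost:
  assumes b: "\<And>j. b j > 0" and "A > 0" "\<tau> > 0" and adm: "admissible M X Q U"
  shows "(\<integral>\<^sup>+\<omega>. ennreal (cycle_cost X U (G A \<tau> lam b) \<omega>) \<partial>M) =
    ennreal (G A \<tau> lam b (full_state Q)) +
    (\<Sum>n. \<integral>\<^sup>+\<omega>. ennreal (g_hat \<tau> lam b (X n \<omega>) / total_rate lam) *
      indicator {\<omega>. enat n < trigger_step X U \<omega>} \<omega> \<partial>M)"
proof -
  let ?G = "G A \<tau> lam b" and ?T = "\<lambda>n. {\<omega>. enat n < trigger_step X U \<omega>}"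
  define d where "d i j = b j * \<P>(r in lead_demand \<tau> lam j. i j \<le> r)" for i j
  \<comment> \<open>The increment of \<open>G\<close> at step \<open>n\<close>, switched off from
    the trigger step on. Almost surely only the summand of the item actually demanded can be
    nonzero.\<close>
  let ?D = "\<lambda>n \<omega>. \<Sum>j\<in>UNIV. (ennreal (d (X n \<omega>) j) * indicator (?T n) \<omega>) *
    indicator {\<omega>. X (Suc n) \<omega> = decr (X n \<omega>) j} \<omega>"
  have d: "d i j \<ge> 0" for i j using b[of j] by (simp add: d_def)
  have [measurable]: "(\<lambda>\<omega>. ennreal (d (X n \<omega>) j)) \<in> borel_measurable M" for n j
    by (rule measurable_compose[OF X_measurable]) simp
  have G_step: "?G (decr i j) = ?G i + d i j" for i j
    unfolding d_def by (rule G_decr[where lam = lam and j = j, OF lam_pos \<open>\<tau> > 0\<close>])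
  have G_nonneg: "?G i \<ge> 0" for i
    by (rule G_nonneg[OF b \<open>A > 0\<close>])
  have [measurable]: "Measurable.pred M (\<lambda>\<omega>. X (Suc n) \<omega> = decr (X n \<omega>) j)" for n j
    by measurable
  \<comment> \<open>\<open>cycle_cost\<close> has the default value 0 on paths that never trigger,
    where the telescoped identity could fail. A finite expected number of steps makes them a null
    set.\<close>
  have fin: "AE \<omega> in M. trigger_step X U \<omega> \<noteq> \<infinity>"
  proof -
    have "AE \<omega> in M. ennreal_of_enat (trigger_step X U \<omega>) \<noteq> \<infinity>"
      using adm by (intro nn_integral_PInf_AE) (auto simp: admissible_def expected_steps_def)
    then show ?thesis by eventually_elim (metis ennreal_of_enat_infty)
  qed
  have D_int: "(\<integral>\<^sup>+\<omega>. ?D n \<omega> \<partial>M) =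
      (\<integral>\<^sup>+\<omega>. ennreal (g_hat \<tau> lam b (X n \<omega>) / total_rate lam) * indicator (?T n) \<omega> \<partial>M)" for n
  proof -
    have "(\<integral>\<^sup>+\<omega>. (ennreal (d (X n \<omega>) j) * indicator (?T n) \<omega>) *
          indicator {\<omega>. X (Suc n) \<omega> = decr (X n \<omega>) j} \<omega> \<partial>M) =
        (\<integral>\<^sup>+\<omega>. ennreal (demand_prob lam j) * (ennreal (d (X n \<omega>) j) * indicator (?T n) \<omega>) \<partial>M)" for j
    proof -
      \<comment> \<open>Writes the integrand as a function of the restricted path, the form that
        \<open>markov_step\<close> takes.\<close>
      have eq: "ennreal (d (X n \<omega>) j) * indicator (?T n) \<omega> =
          (\<lambda>x. ennreal (d (x n) j) * (if \<forall>k\<le>n. x k \<notin> U then 1 else 0)) (restrict (\<lambda>k. X k \<omega>) {..n})" for \<omega>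
        by (auto simp: enat_less_trigger_step indicator_def)
      have "(\<integral>\<^sup>+\<omega>. (ennreal (d (X n \<omega>) j) * indicator (?T n) \<omega>) *
          indicator {\<omega>. X (Suc n) \<omega> = decr (X n \<omega>) j} \<omega> \<partial>M) =
        ennreal (demand_prob lam j) * (\<integral>\<^sup>+\<omega>. ennreal (d (X n \<omega>) j) * indicator (?T n) \<omega> \<partial>M)"
        unfolding eq by (rule markov_step)
      then show ?thesis by (subst nn_integral_cmult) auto
    qed
    then have "(\<integral>\<^sup>+\<omega>. ?D n \<omega> \<partial>M) =
        (\<integral>\<^sup>+\<omega>. (\<Sum>j\<in>UNIV. ennreal (demand_prob lam j) * (ennreal (d (X n \<omega>) j) * indicator (?T n) \<omega>)) \<partial>M)"
      by (subst (1 2) nn_integral_sum) auto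
    also have "\<dots> = (\<integral>\<^sup>+\<omega>. ennreal (g_hat \<tau> lam b (X n \<omega>) / total_rate lam) * indicator (?T n) \<omega> \<partial>M)"
    proof (rule nn_integral_cong)
      fix \<omega>
      have "(\<Sum>j\<in>UNIV. ennreal (demand_prob lam j) * (ennreal (d (X n \<omega>) j) * indicator (?T n) \<omega>)) =
          (\<Sum>j\<in>UNIV. ennreal (demand_prob lam j * d (X n \<omega>) j)) * indicator (?T n) \<omega>"
        using d by (simp add: sum_distrib_right ennreal_mult demand_prob_nonneg mult.assoc)
      also have "(\<Sum>j\<in>UNIV. ennreal (demand_prob lam j * d (X n \<omega>) j)) =
          ennreal (\<Sum>j\<in>UNIV. demand_prob lam j * d (X n \<omega>) j)"
        using d by (intro sum_ennreal mult_nonneg_nonneg demand_prob_nonneg)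
      also have "(\<Sum>j\<in>UNIV. demand_prob lam j * d (X n \<omega>) j) = g_hat \<tau> lam b (X n \<omega>) / total_rate lam"
        by (simp add: g_hat_def d_def demand_prob_def sum_divide_distrib mult.assoc)
      finally show "(\<Sum>j\<in>UNIV. ennreal (demand_prob lam j) * (ennreal (d (X n \<omega>) j) * indicator (?T n) \<omega>)) =
        ennreal (g_hat \<tau> lam b (X n \<omega>) / total_rate lam) * indicator (?T n) \<omega>" .
    qed
    finally show ?thesis .
  qed
  have "(\<integral>\<^sup>+\<omega>. ennreal (cycle_cost X U ?G \<omega>) \<partial>M) = (\<integral>\<^sup>+\<omega>. ennreal (?G (full_state Q)) + (\<Sum>n. ?D n \<omega>) \<partial>M)"
  proof (rule nn_integral_cong_AE, use fin AE_path in eventually_elim)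
    case (elim \<omega>)
    then obtain m where m: "trigger_step X U \<omega> = enat m" by auto
    \<comment> \<open>Monotonicity accompanies the increment because \<open>ennreal\<close> sends
      negative differences to zero, so the telescoping needs them nonnegative.\<close>
    have D: "?D n \<omega> = ennreal (?G (X (Suc n) \<omega>) - ?G (X n \<omega>))" and mono: "?G (X n \<omega>) \<le> ?G (X (Suc n) \<omega>)"
      if "n < m" for n
    proof -
      obtain j where j: "X (Suc n) \<omega> = decr (X n \<omega>) j" using elim by blast
      have "?D n \<omega> = (\<Sum>k\<in>UNIV. if k = j then ennreal (d (X n \<omega>) j) else 0)"
        using that by (intro sum.cong) (auto simp: j m decr_eq_iff indicator_def)
      then show "?D n \<omega> = ennreal (?G (X (Suc n) \<omega>) - ?G (X n \<omega>))"
        by (simp add: j G_step)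
      show "?G (X n \<omega>) \<le> ?G (X (Suc n) \<omega>)"
        by (simp add: j G_step d)
    qed
    have "(\<Sum>n. ?D n \<omega>) = (\<Sum>n<m. ?D n \<omega>)"
      by (rule suminf_finite) (auto simp: m)
    also have "\<dots> = (\<Sum>n<m. ennreal (?G (X (Suc n) \<omega>) - ?G (X n \<omega>)))"
      by (rule sum.cong) (use D in auto)
    also have "\<dots> = ennreal (\<Sum>n<m. ?G (X (Suc n) \<omega>) - ?G (X n \<omega>))"
      by (rule sum_ennreal) (use mono in auto)
    also have "(\<Sum>n<m. ?G (X (Suc n) \<omega>) - ?G (X n \<omega>)) = ?G (X m \<omega>) - ?G (X 0 \<omega>)"
      by (rule sum_lessThan_telescope)
    finally have sum: "(\<Sum>n. ?D n \<omega>) = ennreal (?G (X m \<omega>) - ?G (X 0 \<omega>))" .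
    \<comment> \<open>The total increment must also be nonnegative for \<open>ennreal\<close> to
      turn the sum back into the cost at step \<open>m\<close>.\<close>
    have "?G (X 0 \<omega>) \<le> ?G (X n \<omega>)" if "n \<le> m" for n
      using that
    proof (induction n)
      case (Suc n)
      then show ?case using mono[of n] by simp
    qed simp
    then have "ennreal (?G (X 0 \<omega>)) + ennreal (?G (X m \<omega>) - ?G (X 0 \<omega>)) = ennreal (?G (X m \<omega>))"
      using G_nonneg by (simp add: ennreal_plus[symmetric] del: ennreal_plus)
    then show ?case
      unfolding sum using elim by (simp add: cycle_cost_def m)
  qed
  also have "\<dots> = ennreal (?G (full_state Q)) + (\<Sum>n. \<integral>\<^sup>+\<omega>. ?D n \<omega> \<partial>M)"
    by (subst nn_integral_add) (auto simp: nn_integral_suminf emeasure_space_1)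
  finally show ?thesis unfolding D_int .
qed

end

section \<open>The formulas for cost, length and average cost\<close>

theorem theorem3:
  fixes Q :: "'j::finite \<Rightarrow> nat" and lam b :: "'j \<Rightarrow> real" and A \<tau> :: real
    and M :: "'w measure" and X :: "nat \<Rightarrow> 'w \<Rightarrow> 'j state" and U :: "'j state set"
  assumes "\<And>j. Q j \<ge> 1" and "\<And>j. lam j > 0" and "\<And>j. b j > 0" and "A > 0" and "\<tau> > 0"
    and "inventory_chain M X Q lam"
    and "admissible M X Q U"
  shows
    "integrable M (cycle_cost X U (G A \<tau> lam b)) \<and>
     (\<lambda>i. g_hat \<tau> lam b i / total_rate lam * visit_prob M X U i) summable_on (states Q - U) \<and>
     (\<lambda>i. 1 / total_rate lam * visit_prob M X U i) summable_on (states Q - U) \<and>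
     expected_cost M X U (G A \<tau> lam b) =
       G A \<tau> lam b (full_state Q) +
       (\<Sum>\<^sub>\<infinity>i\<in>states Q - U. g_hat \<tau> lam b i / total_rate lam * visit_prob M X U i) \<and>
     expected_length M X U \<tau> lam =
       \<tau> + (\<Sum>\<^sub>\<infinity>i\<in>states Q - U. 1 / total_rate lam * visit_prob M X U i) \<and>
     average_cost M X U (G A \<tau> lam b) \<tau> lam =
       expected_cost M X U (G A \<tau> lam b) / expected_length M X U \<tau> lam \<and>
     average_cost M X U (G A \<tau> lam b) \<tau> lam =
       (G A \<tau> lam b (full_state Q) +
         (\<Sum>\<^sub>\<infinity>i\<in>states Q - U. g_hat \<tau> lam b i / total_rate lam * visit_prob M X U i)) /
       (\<tau> + (\<Sum>\<^sub>\<infinity>i\<in>states Q - U. 1 / total_rate lam * visit_prob M X U i))"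
proof -
  interpret inventory_process M X Q lam
    using assms by unfold_locales auto
  let ?G = "G A \<tau> lam b" and ?S = "states Q - U" and ?L = "total_rate lam"
  let ?T = "\<lambda>n. {\<omega>. enat n < trigger_step X U \<omega>}"
  let ?gs = "\<Sum>n. \<integral>\<^sup>+\<omega>. ennreal (g_hat \<tau> lam b (X n \<omega>) / ?L) * indicator (?T n) \<omega> \<partial>M"
  \<comment> \<open>Bounding every tail probability by one shows that \<open>K\<close> dominates
    \<open>g_hat / total_rate\<close> uniformly in the state.\<close>
  define K where "K = (\<Sum>j\<in>UNIV. lam j * b j) / ?L"
  have L: "?L > 0" by (rule total_rate_pos)
  have pos: "0 \<le> lam j * b j" for j using assms(2,3)[of j] by simp
  have g0: "0 \<le> g_hat \<tau> lam b i / ?L" for i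
    unfolding g_hat_def using L pos by (intro divide_nonneg_pos sum_nonneg mult_nonneg_nonneg[OF pos]) auto
  have gK: "g_hat \<tau> lam b i / ?L \<le> K" for i
    unfolding g_hat_def K_def using L pos
    by (intro divide_right_mono sum_mono mult_left_le) auto
  have G0: "0 \<le> ?G (full_state Q)"
    by (rule G_nonneg[OF assms(3,4)])
  have cost0: "0 \<le> cycle_cost X U ?G \<omega>" for \<omega>
    by (simp add: cycle_cost_def G_nonneg[OF assms(3,4)] split: enat.split)
  have visit0: "0 \<le> visit_prob M X U i" for i
    by (simp add: visit_prob_def)
  \<comment> \<open>Admissibility makes the expectation finite, so \<open>enn2real\<close> in
    \<open>expected_length\<close> loses nothing.\<close>
  have steps: "expected_steps M X U = ennreal (enn2real (expected_steps M X U))"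
    using assms(7) by (simp add: admissible_def)

  \<comment> \<open>The length formula is the occupation identity for the constant function
    \<open>1 / total_rate lam\<close>.\<close>
  have "(\<integral>\<^sup>+i. ennreal (1 / ?L * visit_prob M X U i) \<partial>count_space ?S) =
      (\<Sum>n. ennreal (1 / ?L) * (\<integral>\<^sup>+\<omega>. indicator (?T n) \<omega> \<partial>M))"
    using L by (subst nn_integral_visits) (auto simp: nn_integral_cmult)
  also have "\<dots> = ennreal (1 / ?L) * expected_steps M X U"
    by (simp add: expected_steps_eq)
  also have "\<dots> = ennreal (enn2real (expected_steps M X U) / ?L)"
    using L by (subst steps) (simp add: ennreal_mult'[symmetric])
  finally have len: "(\<lambda>i. 1 / ?L * visit_prob M X U i) summable_on ?S"
      "(\<Sum>\<^sub>\<infinity>i\<in>?S. 1 / ?L * visit_prob M X U i) = enn2real (expected_steps M X U) / ?L"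
    using L by (auto intro!: nn_integral_count_space_infsum simp: visit_prob_def)

  \<comment> \<open>The cost series is at most \<open>K\<close> times the finite expected number of
    steps. It therefore has a real value \<open>s\<close>, which the occupation identity matches
    with the sum over continue states.\<close>
  have "?gs \<le> (\<Sum>n. ennreal K * (\<integral>\<^sup>+\<omega>. indicator (?T n) \<omega> \<partial>M))"
    by (intro suminf_le summableI)
      (auto simp: nn_integral_cmult[symmetric] intro!: nn_integral_mono mult_right_mono ennreal_leI gK)
  also have "\<dots> = ennreal K * expected_steps M X U"
    by (simp add: expected_steps_eq)
  also have "\<dots> < \<infinity>"
    by (subst steps) (simp add: ennreal_mult_less_top)
  finally obtain s where s: "?gs = ennreal s" "0 \<le> s"
    by (cases ?gs) auto
  have cost: "(\<lambda>i. g_hat \<tau> lam b i / ?L * visit_prob M X U i) summable_on ?S"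
      "(\<Sum>\<^sub>\<infinity>i\<in>?S. g_hat \<tau> lam b i / ?L * visit_prob M X U i) = s"
    using nn_integral_count_space_infsum[OF mult_nonneg_nonneg[OF g0 visit0] _ s(2)]
      nn_integral_visits[of "\<lambda>i. g_hat \<tau> lam b i / ?L" U] g0 s(1) by auto
  have nn: "(\<integral>\<^sup>+\<omega>. ennreal (cycle_cost X U ?G \<omega>) \<partial>M) = ennreal (?G (full_state Q) + s)"
    using nn_integral_cycle_cost[of b A \<tau> U] assms s G0 by simp
  \<comment> \<open>The cost is nonnegative with a finite extended integral, so integrability comes
    out of the computation itself.\<close>
  have int: "integrable M (cycle_cost X U ?G)"
    by (rule integrableI_nonneg) (use cost0 nn in auto)
  have "expected_cost M X U ?G = ?G (full_state Q) + s"
    unfolding expected_cost_def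
    by (subst integral_eq_nn_integral) (use cost0 nn G0 s(2) in \<open>auto simp del: ennreal_plus\<close>)
  then show ?thesis
    using int len cost by (simp add: average_cost_def expected_length_def)
qed

end
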